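(* Fix $N$, $T$, $B>0$ and $\theta\in[0,1]^N$, and let $Q$ be the number of indices $i$ with $\theta_i>0$; assume $2\le Q\le N$. For each $K>1$ let $\mathbf p^*=\mathbf p^*(K)$ be the optimal symmetric strategy for $K$ users and let $L=L(K)=BT\sum_{i=1}^N\theta_i(1-p_i^* )^K$ be its loss relative to centralized scheduling. Then, as $K\to\infty$, $p_i^*\to 1/Q$ for every $i$ with $\theta_i>0$, and $L\to0$ exponentially: with $c_1=\ln\frac{Q}{Q-1}$, there are constants $0<a\le b$ and $K_0$ such that $$a\,e^{-c_1K}\le L\le b\,e^{-c_1K}\qquad\text{for all }K>K_0 .$$
   Context: There are $N$ channels, $K$ users and $T$ time slots. In each slot channel $i$ is free with probability $\theta_i$, independently over channels and slots. In each slot every user independently senses channel $i$ with probability $p_i$ (same vector $\mathbf p$ for all users); if channel $i$ is free, one uniformly chosen user among those sensing it transmits $B$ bits. The optimal symmetric strategy (maximizing the common expected per-user throughput over probability vectors) is, for $K>1$, $$p_i^*=\left\{1-\left(\frac{\lambda^*}{K\theta_i}\right)^{1/(K-1)}\right\}^{+}\ \text{if }\theta_i>0,\qquad p_i^*=0\ \text{if }\theta_i=0,$$ where $\{x\}^+=\max\{0,x\}$ and $\lambda^*\ge0$ is a constant (depending on $K$ and $\theta$) such that $\sum_{i=1}^Np_i^*=1$. The expected total throughput of the $K$ users is $BT\sum_i\theta_i\{1-(1-p_i^* )^K\}$, while the average total spectral opportunity, achieved by a centralized allocation when $K>N$, is $BT\sum_i\theta_i$; the loss $L$ is the difference. *)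

theory Defs
  imports "HOL-Probability.Probability"
begin

text \<open>
  The channels are the elements of a finite type \<open>'c\<close>, the users are the numbers below \<open>K\<close>
  and the slots are the numbers below \<open>T\<close>.  A symmetric strategy is a probability vector over
  the channels, represented as a value of type \<open>'c pmf\<close>.
\<close>

definition channel_state_pmf :: "('c::finite \<Rightarrow> real) \<Rightarrow> ('c \<Rightarrow> bool) pmf" where
  "channel_state_pmf \<theta> = Pi_pmf UNIV undefined (\<lambda>i. bernoulli_pmf (\<theta> i))"

text \<open>
  An outcome of one slot is a triple \<open>(s, c, w)\<close>: channel \<open>i\<close> is free iff \<open>s i\<close>, user \<open>k\<close> senses
  the channel \<open>c k\<close>, and \<open>w i\<close> is the user picked among those sensing channel \<open>i\<close>.  Only
  the values \<open>c k\<close> with \<open>k < K\<close> and \<open>w i\<close> with \<open>i\<close> sensed by some user are meaningful.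
\<close>

type_synonym 'c slot = "('c \<Rightarrow> bool) \<times> (nat \<Rightarrow> 'c) \<times> ('c \<Rightarrow> nat)"

definition slot_pmf :: "('c::finite \<Rightarrow> real) \<Rightarrow> nat \<Rightarrow> 'c pmf \<Rightarrow> 'c slot pmf" where
  "slot_pmf \<theta> K p = do {
     s \<leftarrow> channel_state_pmf \<theta>;
     c \<leftarrow> Pi_pmf {..<K} undefined (\<lambda>_. p);
     w \<leftarrow> Pi_pmf (c ` {..<K}) undefined (\<lambda>i. pmf_of_set {k. k < K \<and> c k = i});
     return_pmf (s, c, w)
   }"

definition transmits :: "nat \<Rightarrow> 'c slot \<Rightarrow> bool" where
  "transmits k = (\<lambda>(s, c, w). s (c k) \<and> w (c k) = k)"

definition user_throughput ::
    "real \<Rightarrow> nat \<Rightarrow> ('c::finite \<Rightarrow> real) \<Rightarrow> nat \<Rightarrow> 'c pmf \<Rightarrow> nat \<Rightarrow> real" where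
  "user_throughput B T \<theta> K p k =
     measure_pmf.expectation (Pi_pmf {..<T} undefined (\<lambda>_. slot_pmf \<theta> K p))
       (\<lambda>\<omega>. \<Sum>t<T. B * of_bool (transmits k (\<omega> t)))"

definition total_throughput ::
    "real \<Rightarrow> nat \<Rightarrow> ('c::finite \<Rightarrow> real) \<Rightarrow> nat \<Rightarrow> 'c pmf \<Rightarrow> real" where
  "total_throughput B T \<theta> K p = (\<Sum>k<K. user_throughput B T \<theta> K p k)"

definition spectral_opportunity ::
    "real \<Rightarrow> nat \<Rightarrow> ('c::finite \<Rightarrow> real) \<Rightarrow> real" where
  "spectral_opportunity B T \<theta> =
     measure_pmf.expectation (Pi_pmf {..<T} undefined (\<lambda>_. channel_state_pmf \<theta>))
       (\<lambda>\<omega>. \<Sum>t<T. \<Sum>i\<in>UNIV. B * of_bool (\<omega> t i))"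

definition loss ::
    "real \<Rightarrow> nat \<Rightarrow> ('c::finite \<Rightarrow> real) \<Rightarrow> nat \<Rightarrow> 'c pmf \<Rightarrow> real" where
  "loss B T \<theta> K p = spectral_opportunity B T \<theta> - total_throughput B T \<theta> K p"

text \<open>
  All users have the same expected throughput, so a strategy that is optimal for one user is
  optimal for every user.
\<close>

definition optimal_symmetric ::
    "real \<Rightarrow> nat \<Rightarrow> ('c::finite \<Rightarrow> real) \<Rightarrow> nat \<Rightarrow> 'c pmf \<Rightarrow> bool" where
  "optimal_symmetric B T \<theta> K p \<longleftrightarrow>
     (\<forall>k<K. \<forall>q. user_throughput B T \<theta> K q k \<le> user_throughput B T \<theta> K p k)"

end

theory Submission
  imports Defs
begin

text \<open>
  Summing the optimality condition over the users shows that an optimal strategy minimizes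
  \<open>F p = \<Sum>i. \<theta> i * (1 - p i) ^ K\<close>, so the form of the minimizer is not needed.
  Comparison with the uniform strategy on the \<open>Q\<close> usable channels gives
  \<open>F p \<le> (\<Sum>i. \<theta> i) * (1 - 1/Q) ^ K\<close>; conversely some usable channel has \<open>p i \<le> 1/Q\<close>, which
  bounds \<open>F p\<close> below by a multiple of \<open>(1 - 1/Q) ^ K\<close>.  The upper bound applied to the single
  term \<open>\<theta> i * (1 - p i) ^ K\<close> gives \<open>p i \<ge> 1 - C powr (1/K) * (1 - 1/Q)\<close>, which tends
  to \<open>1/Q\<close>; as this holds for all \<open>Q\<close> usable channels and the \<open>p i\<close> sum to 1, each tends to
  \<open>1/Q\<close>.
\<close>

section \<open>Probability mass functions\<close>

lemma integrable_of_bool_pmf [simp]: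
  "integrable (measure_pmf M) (\<lambda>x. of_bool (P x) :: real)"
  by (rule measure_pmf.integrable_const_bound[where B = 1]) auto

lemma expectation_of_bool_pmf:
  "measure_pmf.expectation M (\<lambda>x. of_bool (P x) :: real) = measure_pmf.prob M {x. P x}"
proof -
  have "(\<lambda>x. of_bool (P x) :: real) = indicator {x. P x}"
    by (auto simp: indicator_def)
  then show ?thesis by simp
qed

text \<open>Pushing each component forward to the truth value of its event turns the claim into the
  product formula for the mass at \<open>(True, True)\<close>.\<close>

lemma prob_pair_pmf_conj:
  "measure_pmf.prob (pair_pmf M N) {x. P (fst x) \<and> R (snd x)} =
     measure_pmf.prob M {x. P x} * measure_pmf.prob N {x. R x}"
proof -
  have "pmf (map_pmf (\<lambda>(x, y). (P x, R y)) (pair_pmf M N)) (True, True) =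
      pmf (map_pmf P M) True * pmf (map_pmf R N) True"
    by (simp only: map_pair pmf_pair)
  then show ?thesis
    by (simp add: pmf_map vimage_def case_prod_beta)
qed

text \<open>Linearity of expectation, since every coordinate has marginal \<open>M\<close>. This
  reduces \<open>T\<close> slots to a single one.\<close>

lemma expectation_sum_Pi_pmf_iid:
  fixes f :: "'a \<Rightarrow> real"
  assumes "integrable (measure_pmf M) f"
  shows "measure_pmf.expectation (Pi_pmf {..<T} d (\<lambda>_. M)) (\<lambda>\<omega>. \<Sum>t<T. f (\<omega> t)) =
    real T * measure_pmf.expectation M f"
proof -
  let ?P = "Pi_pmf {..<T} d (\<lambda>_. M)"
  have component: "M = map_pmf (\<lambda>\<omega>. \<omega> t) ?P" if "t < T" for t
    using that by (simp add: Pi_pmf_component)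
  have "integrable (measure_pmf ?P) (\<lambda>\<omega>. f (\<omega> t))" if "t < T" for t
    using assms by (subst (asm) component[OF that]) simp
  then have "measure_pmf.expectation ?P (\<lambda>\<omega>. \<Sum>t<T. f (\<omega> t)) =
      (\<Sum>t<T. measure_pmf.expectation ?P (\<lambda>\<omega>. f (\<omega> t)))"
    by (subst Bochner_Integration.integral_sum) auto
  also have "\<dots> = (\<Sum>t<T. measure_pmf.expectation M f)"
  proof (rule sum.cong)
    fix t assume "t \<in> {..<T}"
    then have "t < T" by simp
    show "measure_pmf.expectation ?P (\<lambda>\<omega>. f (\<omega> t)) = measure_pmf.expectation M f"
      by (subst (2) component[OF \<open>t < T\<close>]) simp
  qed simp
  finally show ?thesis by simp
qed

text \<open>Complement: all \<open>K\<close> independent choices must avoid \<open>i\<close>, each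
  with probability \<open>1 - pmf p i\<close>.\<close>

lemma prob_in_image_Pi_pmf_iid:
  "measure_pmf.prob (Pi_pmf {..<K} d (\<lambda>_. p)) {c. i \<in> c ` {..<K}} = 1 - (1 - pmf p i) ^ K"
proof -
  let ?P = "Pi_pmf {..<K} d (\<lambda>_. p)"
  have "measure_pmf.prob p (- {i}) = 1 - pmf p i"
    using measure_pmf.prob_compl[of "{i}" p]
    by (simp add: measure_pmf_single Compl_eq_Diff_UNIV)
  then have "measure_pmf.prob ?P (Pi {..<K} (\<lambda>_. - {i})) = (1 - pmf p i) ^ K"
    by (subst measure_Pi_pmf_Pi) auto
  moreover have "{c. i \<in> c ` {..<K}} = UNIV - Pi {..<K} (\<lambda>_. - {i})"
    by auto
  ultimately show ?thesis
    using measure_pmf.prob_compl[of "Pi {..<K} (\<lambda>_. - {i})" ?P] by simp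
qed

section \<open>Throughput and loss\<close>

lemma prob_channel_free:
  assumes "\<theta> i \<in> {0..1}"
  shows "measure_pmf.prob (channel_state_pmf \<theta>) {s. s i} = \<theta> i"
proof -
  have "map_pmf (\<lambda>s. s i) (channel_state_pmf \<theta>) = bernoulli_pmf (\<theta> i)"
    unfolding channel_state_pmf_def by (subst Pi_pmf_component) auto
  then have "pmf (map_pmf (\<lambda>s. s i) (channel_state_pmf \<theta>)) True = \<theta> i"
    using assms by simp
  then show ?thesis by (simp add: pmf_map vimage_def)
qed

lemma spectral_opportunity_eq:
  assumes "\<And>i. \<theta> i \<in> {0..1}"
  shows "spectral_opportunity B T \<theta> = B * real T * (\<Sum>i\<in>UNIV. \<theta> i)"
proof -
  have "measure_pmf.expectation (channel_state_pmf \<theta>) (\<lambda>s. \<Sum>i\<in>UNIV. B * of_bool (s i)) =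
      (\<Sum>i\<in>UNIV. B * measure_pmf.prob (channel_state_pmf \<theta>) {s. s i})"
    by (subst Bochner_Integration.integral_sum) (simp_all add: expectation_of_bool_pmf)
  then show ?thesis
    unfolding spectral_opportunity_def
    by (subst expectation_sum_Pi_pmf_iid)
      (simp_all add: prob_channel_free[OF assms] sum_distrib_left mult_ac
        del: sum_of_bool_eq sum_mult_of_bool_eq)
qed

text \<open>Once an event no longer mentions the winners, their conditional law sums out and leaves
  independent channel states and user choices.\<close>

lemma slot_pmf_forget_winners:
  "map_pmf (\<lambda>(s, c, w). (s, c)) (slot_pmf \<theta> K p) =
     pair_pmf (channel_state_pmf \<theta>) (Pi_pmf {..<K} undefined (\<lambda>_. p))"
  by (simp add: slot_pmf_def pair_pmf_def map_bind_pmf)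

text \<open>
  Choosing the winner is a bijection from the free sensed channels to the transmitting users, so
  the number of transmissions does not depend on the winners.
\<close>

lemma sum_transmits_eq:
  assumes "x \<in> set_pmf (slot_pmf \<theta> K p)"
  shows "(\<Sum>k<K. of_bool (transmits k x)) =
    (\<Sum>i\<in>UNIV. of_bool (fst x i \<and> i \<in> fst (snd x) ` {..<K}) :: real)"
proof -
  obtain s c w where x: "x = (s, c, w)" by (cases x)
  have w: "w i < K \<and> c (w i) = i" if "i \<in> c ` {..<K}" for i
  proof -
    let ?U = "\<lambda>i. {k. k < K \<and> c k = i}"
    have "w \<in> set_pmf (Pi_pmf (c ` {..<K}) undefined (\<lambda>i. pmf_of_set (?U i)))"
      using assms by (auto simp: x slot_pmf_def)
    then have "w i \<in> set_pmf (pmf_of_set (?U i))"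
      using that by (auto simp: set_Pi_pmf PiE_dflt_def)
    \<comment> \<open>\<open>pmf_of_set\<close> has its set as support only when the set is finite
      and nonempty, which is why \<open>i\<close> must be sensed.\<close>
    moreover have "?U i \<noteq> {}" "finite (?U i)"
      using that by auto
    ultimately show ?thesis
      using set_pmf_of_set[of "?U i"] by simp
  qed
  have "bij_betw w {i. s i \<and> i \<in> c ` {..<K}} {k\<in>{..<K}. s (c k) \<and> w (c k) = k}"
  \<comment> \<open>The inverse of \<open>w\<close> is \<open>c\<close>: \<open>c (w i) = i\<close>
    because winners sense their channel, and \<open>w (c k) = k\<close> is part of
    transmitting.\<close>
  proof (rule bij_betwI[where g = c])
    show "w \<in> {i. s i \<and> i \<in> c ` {..<K}} \<rightarrow> {k\<in>{..<K}. s (c k) \<and> w (c k) = k}"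
      by (intro Pi_I) (simp add: w)
    show "c \<in> {k\<in>{..<K}. s (c k) \<and> w (c k) = k} \<rightarrow> {i. s i \<and> i \<in> c ` {..<K}}"
      by blast
  qed (simp_all add: w)
  then have "card {i. s i \<and> i \<in> c ` {..<K}} = card {k\<in>{..<K}. s (c k) \<and> w (c k) = k}"
    by (rule bij_betw_same_card)
  then show ?thesis
    by (simp add: x transmits_def sum.If_cases of_bool_def Int_def conj_commute conj_left_commute)
qed

text \<open>Summing over the users inside the expectation replaces the transmitters by the free
  sensed channels, whose law follows from independence.\<close>

lemma total_throughput_eq:
  assumes \<theta>: "\<And>i. \<theta> i \<in> {0..1}"
  shows "total_throughput B T \<theta> K p =
    B * real T * (\<Sum>i\<in>UNIV. \<theta> i * (1 - (1 - pmf p i) ^ K))"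
proof -
  let ?S = "slot_pmf \<theta> K p"
  let ?M = "pair_pmf (channel_state_pmf \<theta>) (Pi_pmf {..<K} undefined (\<lambda>_. p))"
  have "total_throughput B T \<theta> K p =
      (\<Sum>k<K. real T * (B * measure_pmf.expectation ?S (\<lambda>x. of_bool (transmits k x))))"
    unfolding total_throughput_def user_throughput_def
    by (subst expectation_sum_Pi_pmf_iid) simp_all
  also have "\<dots> = B * real T * measure_pmf.expectation ?S (\<lambda>x. \<Sum>k<K. of_bool (transmits k x))"
    by (subst Bochner_Integration.integral_sum) (simp_all add: sum_distrib_left mult_ac)
  \<comment> \<open>The two counts are known to agree only on the support of \<open>?S\<close>,
    hence the almost-everywhere congruence.\<close>
  also have "measure_pmf.expectation ?S (\<lambda>x. \<Sum>k<K. of_bool (transmits k x)) =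
      measure_pmf.expectation ?S
        (\<lambda>x. \<Sum>i\<in>UNIV. of_bool (fst x i \<and> i \<in> fst (snd x) ` {..<K}) :: real)"
    by (rule integral_cong_AE)
      (simp_all add: AE_measure_pmf_iff sum_transmits_eq del: sum_of_bool_eq)
  also have "\<dots> = measure_pmf.expectation (map_pmf (\<lambda>(s, c, w). (s, c)) ?S)
      (\<lambda>y. \<Sum>i\<in>UNIV. of_bool (fst y i \<and> i \<in> snd y ` {..<K}))"
    by (simp add: case_prod_beta)
  also have "\<dots> = (\<Sum>i\<in>UNIV. measure_pmf.prob ?M {y. fst y i \<and> i \<in> snd y ` {..<K}})"
    unfolding slot_pmf_forget_winners
    by (subst Bochner_Integration.integral_sum)
      (simp_all only: integrable_of_bool_pmf expectation_of_bool_pmf)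
  also have "\<dots> = (\<Sum>i\<in>UNIV. \<theta> i * (1 - (1 - pmf p i) ^ K))"
    by (simp only: prob_pair_pmf_conj[of _ _ "\<lambda>s. s i" "\<lambda>c. i \<in> c ` {..<K}" for i]
        prob_channel_free[OF \<theta>] prob_in_image_Pi_pmf_iid)
  finally show ?thesis .
qed

lemma loss_eq:
  assumes "\<And>i. \<theta> i \<in> {0..1}"
  shows "loss B T \<theta> K p = B * real T * (\<Sum>i\<in>UNIV. \<theta> i * (1 - pmf p i) ^ K)"
  by (simp add: loss_def spectral_opportunity_eq[OF assms] total_throughput_eq[OF assms]
      right_diff_distrib sum_subtractf)

lemma optimal_symmetric_loss_le:
  assumes "optimal_symmetric B T \<theta> K p"
  shows "loss B T \<theta> K p \<le> loss B T \<theta> K q"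
  using assms
  by (auto simp: loss_def total_throughput_def optimal_symmetric_def intro!: sum_mono)

section \<open>Asymptotics\<close>

text \<open>Pigeonhole: otherwise the mass of \<open>A\<close> would exceed 1.\<close>

lemma exists_pmf_le_inverse_card:
  fixes p :: "'c::finite pmf"
  assumes "A \<noteq> {}"
  shows "\<exists>i\<in>A. pmf p i \<le> 1 / real (card A)"
proof (rule ccontr)
  assume "\<not> ?thesis"
  then have "(\<Sum>i\<in>A. 1 / real (card A)) < (\<Sum>i\<in>A. pmf p i)"
    using assms by (intro sum_strict_mono) (auto simp: not_le)
  also have "\<dots> \<le> 1"
    by (metis finite measure_measure_pmf_finite measure_pmf.prob_le_1)
  finally show False using assms by simp
qed

text \<open>The limits of the lower bounds add up to 1 over \<open>A\<close>. Total mass at most 1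
  therefore turns the lower bounds on the other points into an upper bound on
  \<open>pmf (p K) i\<close> with the same limit.\<close>

lemma pmf_tendsto_inverse_card:
  fixes p :: "nat \<Rightarrow> 'c::finite pmf"
  assumes "i \<in> A"
    and lower: "\<And>j. j \<in> A \<Longrightarrow> \<forall>\<^sub>F K in sequentially. l j K \<le> pmf (p K) j"
    and lim: "\<And>j. j \<in> A \<Longrightarrow> l j \<longlonglongrightarrow> 1 / real (card A)"
  shows "(\<lambda>K. pmf (p K) i) \<longlonglongrightarrow> 1 / real (card A)"
proof (rule tendsto_sandwich[OF lower[OF \<open>i \<in> A\<close>] _ lim[OF \<open>i \<in> A\<close>]])
  have "\<forall>\<^sub>F K in sequentially. \<forall>j\<in>A. l j K \<le> pmf (p K) j"
    by (rule eventually_ball_finite) (use lower in auto)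
  then show "\<forall>\<^sub>F K in sequentially. pmf (p K) i \<le> 1 - (\<Sum>j\<in>A - {i}. l j K)"
  proof eventually_elim
    case (elim K)
    then have "(\<Sum>j\<in>A - {i}. l j K) \<le> (\<Sum>j\<in>A - {i}. pmf (p K) j)"
      by (intro sum_mono) auto
    moreover have "pmf (p K) i + (\<Sum>j\<in>A - {i}. pmf (p K) j) \<le> 1"
      using \<open>i \<in> A\<close>
      by (metis finite measure_measure_pmf_finite measure_pmf.prob_le_1 sum.remove)
    ultimately show ?case by simp
  qed
  have "(\<lambda>K. 1 - (\<Sum>j\<in>A - {i}. l j K)) \<longlonglongrightarrow> 1 - (\<Sum>j\<in>A - {i}. 1 / real (card A))"
    by (intro tendsto_intros lim) auto
  moreover have "1 - (\<Sum>j\<in>A - {i}. 1 / real (card A)) = 1 / real (card A)"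
  proof -
    have "card A > 0" using \<open>i \<in> A\<close> by (auto simp: card_gt_0_iff)
    then show ?thesis using \<open>i \<in> A\<close> by (auto simp: diff_divide_distrib)
  qed
  ultimately show "(\<lambda>K. 1 - (\<Sum>j\<in>A - {i}. l j K)) \<longlonglongrightarrow> 1 / real (card A)"
    by simp
qed

theorem lemma7:
  fixes B :: real and T Q :: nat and \<theta> :: "'c::finite \<Rightarrow> real"
    and p :: "nat \<Rightarrow> 'c pmf" and L :: "nat \<Rightarrow> real" and c\<^sub>1 :: real
  assumes "B > 0" and "T > 0"
    and "\<And>i. \<theta> i \<in> {0..1}"
    and "Q = card {i. \<theta> i > 0}" and "2 \<le> Q"
    and "\<And>K. K > 1 \<Longrightarrow> optimal_symmetric B T \<theta> K (p K)"
    and "\<And>K. L K = loss B T \<theta> K (p K)"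
    and "c\<^sub>1 = ln (real Q / (real Q - 1))"
  shows "(\<forall>K>1. L K = B * real T * (\<Sum>i\<in>UNIV. \<theta> i * (1 - pmf (p K) i) ^ K))
    \<and> (\<forall>i. \<theta> i > 0 \<longrightarrow> (\<lambda>K. pmf (p K) i) \<longlonglongrightarrow> 1 / real Q)
    \<and> L \<longlonglongrightarrow> 0
    \<and> (\<exists>a b K\<^sub>0. 0 < a \<and> a \<le> b \<and>
         (\<forall>K>K\<^sub>0. a * exp (- c\<^sub>1 * real K) \<le> L K \<and> L K \<le> b * exp (- c\<^sub>1 * real K)))"
proof -
  define S where "S = {i. \<theta> i > 0}"
  define \<Theta> where "\<Theta> = (\<Sum>i\<in>UNIV. \<theta> i)"
  define m where "m = Min (\<theta> ` S)"
  \<comment> \<open>The probability that a user choosing uniformly from \<open>S\<close> misses a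
    given channel of \<open>S\<close>. It equals \<open>exp (- c\<^sub>1)\<close>.\<close>
  define r where "r = 1 - 1 / real Q"
  note loss_eq' = loss_eq[of \<theta> B T, OF assms(3)]
  have L_eq: "L K = B * real T * (\<Sum>i\<in>UNIV. \<theta> i * (1 - pmf (p K) i) ^ K)" for K
    by (simp add: assms(7) loss_eq')
  have BT: "B * real T > 0" using assms(1,2) by simp
  have card_S: "card S = Q" by (simp add: S_def assms(4))
  have S_ne: "S \<noteq> {}" using card_S assms(5) by auto
  have \<theta>_nonneg: "\<theta> i \<ge> 0" for i using assms(3)[of i] by simp
  have m_pos: "m > 0" unfolding m_def using S_ne by (simp add: S_def)
  have m_le: "m \<le> \<theta> i" if "i \<in> S" for i unfolding m_def using that by simp
  have r: "0 < r" "r < 1" using assms(5) by (auto simp: r_def)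
  have exp_c: "exp (- c\<^sub>1 * real K) = r ^ K" for K
  proof -
    have "- c\<^sub>1 = ln r"
      using assms(5) ln_inverse[of "real Q / (real Q - 1)"]
      by (simp add: assms(8) r_def field_simps)
    then show ?thesis
      using r by (simp add: exp_of_nat2_mult)
  qed
  have upper: "L K \<le> B * real T * (\<Theta> * r ^ K)" if "K > 1" for K
  proof -
    let ?u = "pmf_of_set S"
    \<comment> \<open>Outside \<open>S\<close> the powers differ, but the factor
      \<open>\<theta> i\<close> vanishes.\<close>
    have "\<theta> i * (1 - pmf ?u i) ^ K = \<theta> i * r ^ K" for i
    proof (cases "i \<in> S")
      case True
      then show ?thesis using S_ne by (simp add: card_S r_def)
    next
      case False
      then have "\<theta> i = 0" using \<theta>_nonneg[of i] by (simp add: S_def)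
      then show ?thesis by simp
    qed
    then have "loss B T \<theta> K ?u = B * real T * (\<Theta> * r ^ K)"
      by (simp only: loss_eq' \<Theta>_def sum_distrib_right)
    then show ?thesis
      using optimal_symmetric_loss_le[OF assms(6)[OF that], of ?u] by (simp add: assms(7))
  qed
  have term_le: "B * real T * (\<theta> i * (1 - pmf (p K) i) ^ K) \<le> L K" for i K
    unfolding L_eq using BT \<theta>_nonneg
    by (intro mult_left_mono member_le_sum) (auto simp: pmf_le_1)
  have lower: "B * real T * (m * r ^ K) \<le> L K" for K
  proof -
    obtain i where i: "i \<in> S" "pmf (p K) i \<le> 1 / real Q"
      using exists_pmf_le_inverse_card[OF S_ne] card_S by metis
    then have "m * r ^ K \<le> \<theta> i * (1 - pmf (p K) i) ^ K"
      using r m_pos m_le[OF i(1)] by (intro mult_mono power_mono) (auto simp: r_def)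
    then have "B * real T * (m * r ^ K) \<le> B * real T * (\<theta> i * (1 - pmf (p K) i) ^ K)"
      using BT by (intro mult_left_mono) auto
    then show ?thesis using term_le[of i K] by linarith
  qed
  have pmf_ge: "1 - root K (\<Theta> / \<theta> i) * r \<le> pmf (p K) i" if "i \<in> S" "K > 1" for i K
  proof -
    have "\<theta> i > 0" using that by (simp add: S_def)
    have "B * real T * (\<theta> i * (1 - pmf (p K) i) ^ K) \<le> B * real T * (\<Theta> * r ^ K)"
      using term_le[of i K] upper[OF that(2)] by linarith
    then have "\<theta> i * (1 - pmf (p K) i) ^ K \<le> \<Theta> * r ^ K"
      using BT mult_le_cancel_left_pos by blast
    then have "(1 - pmf (p K) i) ^ K \<le> \<Theta> / \<theta> i * r ^ K"
      using \<open>\<theta> i > 0\<close> by (simp add: field_simps)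
    \<comment> \<open>\<open>root K\<close> is monotone as \<open>K > 0\<close>, and it undoes the
      power because \<open>1 - pmf (p K) i\<close> is nonnegative.\<close>
    then have "root K ((1 - pmf (p K) i) ^ K) \<le> root K (\<Theta> / \<theta> i * r ^ K)"
      using that by simp
    then show ?thesis
      using that r
      by (simp add: real_root_mult real_root_power_cancel pmf_le_1 del: times_divide_eq_left)
  qed
  have "(\<lambda>K. pmf (p K) i) \<longlonglongrightarrow> 1 / real Q" if "\<theta> i > 0" for i
    unfolding card_S[symmetric]
  proof (rule pmf_tendsto_inverse_card)
    show "i \<in> S" using that by (simp add: S_def)
    fix j assume "j \<in> S"
    then show "\<forall>\<^sub>F K in sequentially. 1 - root K (\<Theta> / \<theta> j) * r \<le> pmf (p K) j"
      using pmf_ge by (intro eventually_mono[OF eventually_gt_at_top[of 1]])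
    \<comment> \<open>These make \<open>\<Theta> / \<theta> j\<close> a positive constant, so its
      \<open>K\<close>-th root tends to 1.\<close>
    have "\<theta> j > 0" "\<Theta> \<ge> \<theta> j"
      using \<open>j \<in> S\<close> \<theta>_nonneg by (auto simp: S_def \<Theta>_def intro!: member_le_sum)
    then have "(\<lambda>K. 1 - root K (\<Theta> / \<theta> j) * r) \<longlonglongrightarrow> 1 - 1 * r"
      by (intro tendsto_intros LIMSEQ_root_const) auto
    then show "(\<lambda>K. 1 - root K (\<Theta> / \<theta> j) * r) \<longlonglongrightarrow> 1 / real (card S)"
      by (simp add: r_def card_S)
  qed
  moreover have "L \<longlonglongrightarrow> 0"
  proof (rule tendsto_sandwich)
    show "\<forall>\<^sub>F K in sequentially. 0 \<le> L K"
    proof (intro always_eventually allI)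
      fix K
      have "0 \<le> B * real T * (m * r ^ K)" using BT m_pos r by simp
      then show "0 \<le> L K" using lower[of K] by linarith
    qed
    show "\<forall>\<^sub>F K in sequentially. L K \<le> B * real T * (\<Theta> * r ^ K)"
      using upper by (rule eventually_mono[OF eventually_gt_at_top[of 1]])
    show "(\<lambda>K. B * real T * (\<Theta> * r ^ K)) \<longlonglongrightarrow> 0"
      using r by (intro tendsto_mult_right_zero LIMSEQ_power_zero) auto
  qed auto
  moreover have "\<exists>a b K\<^sub>0. 0 < a \<and> a \<le> b \<and>
      (\<forall>K>K\<^sub>0. a * exp (- c\<^sub>1 * real K) \<le> L K \<and> L K \<le> b * exp (- c\<^sub>1 * real K))"
  \<comment> \<open>The witnesses are \<open>a = B * real T * m\<close>,
    \<open>b = B * real T * \<Theta>\<close> and \<open>K\<^sub>0 = 1\<close>, the last because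
    optimality is assumed for \<open>K > 1\<close>.\<close>
  proof (intro exI conjI allI impI)
    show "0 < B * real T * m" using BT m_pos by simp
    obtain i where "i \<in> S" using S_ne by auto
    then have "m \<le> \<Theta>"
      using m_le[of i] \<theta>_nonneg member_le_sum[of i UNIV \<theta>] by (simp add: \<Theta>_def)
    then show "B * real T * m \<le> B * real T * \<Theta>" using BT by (intro mult_left_mono) auto
    fix K :: nat assume "1 < K"
    show "B * real T * m * exp (- c\<^sub>1 * real K) \<le> L K"
      unfolding exp_c using lower[of K] by (simp add: mult.assoc)
    show "L K \<le> B * real T * \<Theta> * exp (- c\<^sub>1 * real K)"
      unfolding exp_c using upper[OF \<open>1 < K\<close>] by (simp add: mult.assoc)
  qed
  ultimately show ?thesis using L_eq by blast
qed

end
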